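(* Let $X$ be a Banach space with $\dim X\ge 2$, let $\alpha,\beta,\gamma>0$ and let $p\ge 1$. Then $$\frac{1}{2^{p-2}}\le C_{\mathrm{NJ}}^p(\alpha,\beta,\gamma,X)\le 2 .$$
   Context: For a Banach space $X$, $\alpha,\beta,\gamma>0$ and real $p\ge 1$, define $$C_{\mathrm{NJ}}^p(\alpha,\beta,\gamma,X)=\sup\left\{\frac{\alpha^{p/2}\|\beta x+\gamma y\|^p+\beta^{p/2}\|\gamma x-\alpha y\|^p}{2^{p-2}\left[(\alpha\beta)^{p/2}+\gamma^p\right]\left(\beta^{p/2}\|x\|^p+\alpha^{p/2}\|y\|^p\right)}: x,y\in X,\ (x,y)\ne(0,0)\right\}.$$ *)

theory Defs
  imports "HOL-Analysis.Analysis"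
begin

(* The supremum is taken in the extended reals, so it is meaningful without first
   showing that the quotients are bounded above. *)
definition C_NJ :: "real \<Rightarrow> real \<Rightarrow> real \<Rightarrow> real \<Rightarrow> 'a::banach itself \<Rightarrow> ereal" where
  "C_NJ p \<alpha> \<beta> \<gamma> X =
     Sup {ereal ((\<alpha> powr (p/2) * norm (\<beta> *\<^sub>R x + \<gamma> *\<^sub>R y) powr p
                  + \<beta> powr (p/2) * norm (\<gamma> *\<^sub>R x - \<alpha> *\<^sub>R y) powr p)
                / (2 powr (p - 2) * ((\<alpha> * \<beta>) powr (p/2) + \<gamma> powr p)
                   * (\<beta> powr (p/2) * norm x powr p + \<alpha> powr (p/2) * norm y powr p)))
         | x y :: 'a. (x, y) \<noteq> (0, 0)}"

end

theory Submission
  imports Defs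
begin

text \<open>
  Write \<open>K = (\<alpha>\<beta>)\<^sup>p\<^sup>/\<^sup>2 + \<gamma>\<^sup>p\<close> and \<open>D = \<beta>\<^sup>p\<^sup>/\<^sup>2 \<parallel>x\<parallel>\<^sup>p + \<alpha>\<^sup>p\<^sup>/\<^sup>2 \<parallel>y\<parallel>\<^sup>p\<close>. The weights in the constant
  are chosen so that, once the mixed norms are split into pure ones, the coefficients of
  \<open>\<parallel>x\<parallel>\<^sup>p\<close> and \<open>\<parallel>y\<parallel>\<^sup>p\<close> in the numerator factor as \<open>K \<beta>\<^sup>p\<^sup>/\<^sup>2\<close> and \<open>K \<alpha>\<^sup>p\<^sup>/\<^sup>2\<close>, because
  \<open>\<alpha>\<^sup>p = (\<alpha>\<^sup>p\<^sup>/\<^sup>2)\<^sup>2\<close> and likewise for \<open>\<beta>\<close>.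

  For the lower bound take \<open>y = 0\<close> and any \<open>x \<noteq> 0\<close>: there is nothing to split, the numerator
  is exactly \<open>K D\<close>, and the quotient is \<open>1 / 2\<^sup>p\<^sup>-\<^sup>2\<close>. For the upper bound, the triangle
  inequality and the convexity of \<open>t\<^sup>p\<close> split each mixed norm at the price of a factor
  \<open>2\<^sup>p\<^sup>-\<^sup>1\<close>, so the numerator is at most \<open>2\<^sup>p\<^sup>-\<^sup>1 K D\<close> for every pair, which is twice the
  denominator.
\<close>

text \<open>This is convexity of \<open>t\<^sup>p\<close> at the midpoint of two positive numbers; if one of them
  vanishes, it reduces to \<open>1 \<le> 2\<^sup>p\<^sup>-\<^sup>1\<close>.\<close>

lemma powr_add_le_two_powr:
  fixes a b p :: real
  assumes "0 \<le> a" "0 \<le> b" "1 \<le> p"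
  shows "(a + b) powr p \<le> 2 powr (p - 1) * (a powr p + b powr p)"
proof (cases "a = 0 \<or> b = 0")
  case True
  have "1 \<le> 2 powr (p - 1)"
    using assms by (simp add: ge_one_powr_ge_zero)
  then have "1 * c powr p \<le> 2 powr (p - 1) * c powr p" for c
    by (intro mult_right_mono) auto
  then show ?thesis using True by auto
next
  case False
  with assms have pos: "0 < a" "0 < b" by auto
  have "((1 - 1/2) *\<^sub>R a + (1/2) *\<^sub>R b) powr p \<le> (1 - 1/2) * a powr p + (1/2) * b powr p"
    by (rule convex_onD[OF powr_convex[OF assms(3)]]) (use pos in auto)
  then have "((a + b) / 2) powr p \<le> (a powr p + b powr p) / 2"
    by (simp add: add_divide_distrib)
  then have "(a + b) powr p / 2 powr p \<le> (a powr p + b powr p) / 2"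
    using pos by (simp add: powr_divide)
  then show ?thesis
    by (simp add: powr_diff field_simps)
qed

lemma norm_add_powr_le:
  fixes u v :: "'a::real_normed_vector"
  assumes "1 \<le> p"
  shows "norm (u + v) powr p \<le> 2 powr (p - 1) * (norm u powr p + norm v powr p)"
proof -
  have "norm (u + v) powr p \<le> (norm u + norm v) powr p"
    using assms by (intro powr_mono2) (auto simp: norm_triangle_ineq)
  also have "\<dots> \<le> 2 powr (p - 1) * (norm u powr p + norm v powr p)"
    using assms by (intro powr_add_le_two_powr) auto
  finally show ?thesis .
qed

lemma powr_eq_square_powr_half:
  fixes a p :: real
  shows "a powr p = a powr (p/2) * a powr (p/2)"
  by (simp flip: powr_add)

lemma NJ_numerator_le:
  fixes x y :: "'a::real_normed_vector"
  assumes "\<alpha> > 0" "\<beta> > 0" "\<gamma> > 0" "p \<ge> 1"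
  shows "\<alpha> powr (p/2) * norm (\<beta> *\<^sub>R x + \<gamma> *\<^sub>R y) powr p
           + \<beta> powr (p/2) * norm (\<gamma> *\<^sub>R x - \<alpha> *\<^sub>R y) powr p
         \<le> 2 powr (p - 1) * ((\<alpha> * \<beta>) powr (p/2) + \<gamma> powr p)
             * (\<beta> powr (p/2) * norm x powr p + \<alpha> powr (p/2) * norm y powr p)"
    (is "?N \<le> _")
proof -
  have 1: "norm (\<beta> *\<^sub>R x + \<gamma> *\<^sub>R y) powr p
      \<le> 2 powr (p - 1) * (\<beta> powr p * norm x powr p + \<gamma> powr p * norm y powr p)"
    using norm_add_powr_le[of p "\<beta> *\<^sub>R x" "\<gamma> *\<^sub>R y"] assms by (simp add: powr_mult)
  have 2: "norm (\<gamma> *\<^sub>R x - \<alpha> *\<^sub>R y) powr p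
      \<le> 2 powr (p - 1) * (\<gamma> powr p * norm x powr p + \<alpha> powr p * norm y powr p)"
    using norm_add_powr_le[of p "\<gamma> *\<^sub>R x" "- (\<alpha> *\<^sub>R y)"] assms by (simp add: powr_mult)
  have "?N \<le> \<alpha> powr (p/2)
        * (2 powr (p - 1) * (\<beta> powr p * norm x powr p + \<gamma> powr p * norm y powr p))
      + \<beta> powr (p/2)
        * (2 powr (p - 1) * (\<gamma> powr p * norm x powr p + \<alpha> powr p * norm y powr p))"
    by (intro add_mono mult_left_mono 1 2) auto
  also have "\<dots> = 2 powr (p - 1) * ((\<alpha> * \<beta>) powr (p/2) + \<gamma> powr p)
             * (\<beta> powr (p/2) * norm x powr p + \<alpha> powr (p/2) * norm y powr p)"
    using assms
    by (simp add: powr_mult powr_eq_square_powr_half[of \<alpha> p] powr_eq_square_powr_half[of \<beta> p]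
        algebra_simps)
  finally show ?thesis .
qed

text \<open>On the axis \<open>y = 0\<close> the quotient takes one and the same value at every \<open>x \<noteq> 0\<close>, and this
  value is the claimed lower bound.\<close>

lemma NJ_numerator_axis:
  fixes x :: "'a::real_normed_vector"
  assumes "\<alpha> > 0" "\<beta> > 0" "\<gamma> > 0"
  shows "\<alpha> powr (p/2) * norm (\<beta> *\<^sub>R x) powr p + \<beta> powr (p/2) * norm (\<gamma> *\<^sub>R x) powr p
         = ((\<alpha> * \<beta>) powr (p/2) + \<gamma> powr p) * (\<beta> powr (p/2) * norm x powr p)"
  using assms by (simp add: powr_mult powr_eq_square_powr_half[of \<beta> p] algebra_simps)

theorem proposition2:
  fixes \<alpha> \<beta> \<gamma> p :: real
  assumes dim_ge_2: "\<exists>B :: 'a::banach set. independent B \<and> card B = 2"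
    and "\<alpha> > 0" and "\<beta> > 0" and "\<gamma> > 0" and "p \<ge> 1"
  shows "ereal (1 / 2 powr (p - 2)) \<le> C_NJ p \<alpha> \<beta> \<gamma> TYPE('a)
       \<and> C_NJ p \<alpha> \<beta> \<gamma> TYPE('a) \<le> 2"
proof
  define K where "K = (\<alpha> * \<beta>) powr (p/2) + \<gamma> powr p"
  have K: "K > 0" using assms by (simp add: K_def add_pos_pos)

  obtain B :: "'a set" where B: "independent B" "card B = 2" using dim_ge_2 by blast
  then obtain x where "x \<in> B" by fastforce
  with B have x: "x \<noteq> 0" using dependent_zero by blast
  define D where "D = \<beta> powr (p/2) * norm x powr p"
  have D: "D > 0" using assms x by (simp add: D_def)
  have "\<alpha> powr (p/2) * norm (\<beta> *\<^sub>R x) powr p + \<beta> powr (p/2) * norm (\<gamma> *\<^sub>R x) powr p = K * D"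
    unfolding K_def D_def by (rule NJ_numerator_axis) (use assms in auto)
  then have "1 / 2 powr (p - 2) =
      (\<alpha> powr (p/2) * norm (\<beta> *\<^sub>R x + \<gamma> *\<^sub>R 0) powr p
        + \<beta> powr (p/2) * norm (\<gamma> *\<^sub>R x - \<alpha> *\<^sub>R 0) powr p)
      / (2 powr (p - 2) * K * (\<beta> powr (p/2) * norm x powr p + \<alpha> powr (p/2) * norm (0::'a) powr p))"
    using K D by (simp add: D_def[symmetric] del: norm_scaleR)
  then show "ereal (1 / 2 powr (p - 2)) \<le> C_NJ p \<alpha> \<beta> \<gamma> TYPE('a)"
    unfolding C_NJ_def K_def by (intro Sup_upper) (use x in blast)

  show "C_NJ p \<alpha> \<beta> \<gamma> TYPE('a) \<le> 2"
    unfolding C_NJ_def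
  proof (rule Sup_least, elim CollectE exE conjE)
    fix q and x y :: 'a
    assume xy: "(x, y) \<noteq> (0, 0)"
    let ?N = "\<alpha> powr (p/2) * norm (\<beta> *\<^sub>R x + \<gamma> *\<^sub>R y) powr p
        + \<beta> powr (p/2) * norm (\<gamma> *\<^sub>R x - \<alpha> *\<^sub>R y) powr p"
    let ?D = "\<beta> powr (p/2) * norm x powr p + \<alpha> powr (p/2) * norm y powr p"
    assume q: "q = ereal (?N / (2 powr (p - 2) * ((\<alpha> * \<beta>) powr (p/2) + \<gamma> powr p) * ?D))"
    have "?D > 0"
      using xy assms by (cases "x = 0") (auto simp: add_pos_nonneg)
    moreover have "?N \<le> 2 powr (p - 1) * K * ?D"
      unfolding K_def by (rule NJ_numerator_le) (use assms in auto)
    moreover have "2 powr (p - 1) = 2 * 2 powr (p - 2)"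
      by (simp add: powr_diff)
    ultimately have "?N / (2 powr (p - 2) * K * ?D) \<le> 2"
      using K by (simp add: pos_divide_le_eq mult_ac)
    then show "q \<le> 2"
      by (simp add: q K_def)
  qed
qed

end
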